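(* Let $p\ge 1$, $r\ge 1$ and $n \ge 1$ be integers, let $\delta_1,\ldots,\delta_n$ be the random relative errors produced by a sequence of $n$ elementary operations performed using limited-precision stochastic rounding $\mathrm{SR}_{p,r}$, and let $\beta_1,\ldots,\beta_n$ be the corresponding relative errors incurred by the truncation $\mathrm{fl}_{p+r}$ (the $k$-th operation has exact result $c_k$, with $\mathrm{SR}_{p,r}(c_k)=c_k(1+\delta_k)$ and $\mathrm{fl}_{p+r}(c_k)=c_k(1+\beta_k)$). Then the random variables $\alpha_k=\delta_k-\beta_k$, $1\le k\le n$, are mean independent, that is, $$\mathbb{E}(\alpha_k\mid \alpha_1,\ldots,\alpha_{k-1})=\mathbb{E}(\alpha_k)=0 .$$ Moreover, for all $1\le i\le n$, $$\prod_{k=i}^{n}(1+\delta_k)=\prod_{k=i}^{n}(1+\alpha_k)+\mathcal{B}_i,$$ where $$\mathcal{B}_i=\sum_{\substack{K\subseteq \mathcal{I}_i\\ K\ne \mathcal{I}_i}}\left(\prod_{\ell\in K}(1+\alpha_\ell)\prod_{j\in \mathcal{I}_i\setminus K}\beta_j\right),\qquad \mathcal{I}_i=\{k\in\mathbb{N}: i\le k\le n\},$$ and $$|\mathcal{B}_i|\le \gamma_{n-i+1}(u_p+u_{p+r})-\gamma_{n-i+1}(u_p).$$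
   Context: Notation: $u_q=2^{1-q}$ for an integer $q\ge1$, and $\gamma_m(x)=(1+x)^m-1$. Empty products equal $1$. Floating-point numbers: $\mathcal{F}$ is the precision-$p$ binary floating-point system, i.e. the set of $0$ and all real numbers $(-1)^s 2^e m$ with $s\in\{0,1\}$, $e$ an integer exponent, and $m\in[1,2)$ having at most $p$ significant bits. Standard model: no underflow or overflow occurs (the exponent range may be regarded as unlimited). For $x\in\mathbb{R}$, $\lceil x\rceil_p=\min\{y\in\mathcal{F}:y\ge x\}$ and $\lfloor x\rfloor_p=\max\{y\in\mathcal{F}:y\le x\}$. For $x\neq0$ written uniquely as $x=(-1)^s2^em$ with $m\in[1,2)$ real, $\mathrm{ulp}_p(x)=2^{e-p+1}$, and $\mathrm{fl}_{p+r}(x)$ is $x$ with the binary expansion of its significand $m$ truncated to the first $p+r$ significant bits; $\mathrm{fl}_{p+r}(0)=0$. Limited-precision stochastic rounding with $r$ random bits: $\mathrm{SR}_{p,r}(0)=0$, and for $x\ne0$, $\mathrm{SR}_{p,r}(x)$ is the random variable equal to $\lceil x\rceil_p$ with probability $q_r(x)$ and to $\lfloor x\rfloor_p$ with probability $1-q_r(x)$, where $q_r(x)=(\mathrm{fl}_{p+r}(x)-\lfloor x\rfloor_p)/\mathrm{ulp}_p(x)$. Sequence of operations: the $k$-th operation is an elementary operation ($+,-,\times,\div$ or square root) whose operands are deterministic inputs or quantities determined by the results of the previous operations, so its exact result $c_k$ is a function of $\delta_1,\ldots,\delta_{k-1}$; conditionally on the previous roundings, $\mathrm{SR}_{p,r}(c_k)$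 has the two-point distribution above with $x=c_k$. If $c_k=0$, then $\delta_k=\beta_k=0$ by convention. *)

theory Defs
  imports "HOL-Probability.Probability"
begin

section \<open>Floating-point numbers with unlimited exponent range\<close>

definition u :: "nat \<Rightarrow> real" where
  "u q = 2 powi (1 - int q)"

definition gam :: "nat \<Rightarrow> real \<Rightarrow> real" where
  "gam m x = (1 + x) ^ m - 1"

text \<open>
  A significand \<open>m \<in> [1,2)\<close> has at most \<open>p\<close> significant bits iff it is an integer multiple of
  \<open>2 ^ (1 - p)\<close>; the precision is always at least 1.
\<close>

definition float_system :: "nat \<Rightarrow> real set" where
  "float_system p = {0} \<union>
     {(-1) ^ s * 2 powi e * m | (s :: nat) (e :: int) (m :: real).
        s \<in> {0, 1} \<and> 1 \<le> m \<and> m < 2 \<and> m * 2 ^ (p - 1) \<in> \<int>}"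

definition fl_up :: "nat \<Rightarrow> real \<Rightarrow> real" where
  "fl_up p x = (LEAST y. y \<in> float_system p \<and> x \<le> y)"

definition fl_down :: "nat \<Rightarrow> real \<Rightarrow> real" where
  "fl_down p x = (GREATEST y. y \<in> float_system p \<and> y \<le> x)"

text \<open>Exponent and significand of a nonzero real; they are characterised by the two lemmas below.\<close>

definition fexp :: "real \<Rightarrow> int" where
  "fexp x = \<lfloor>log 2 \<bar>x\<bar>\<rfloor>"

definition signif :: "real \<Rightarrow> real" where
  "signif x = \<bar>x\<bar> / 2 powi fexp x"

lemma fexp_signif:
  assumes "x \<noteq> 0"
  shows "x = sgn x * 2 powi fexp x * signif x" and "1 \<le> signif x" and "signif x < 2"
proof -
  have eq: "2 powi fexp x = (2 :: real) powr of_int (fexp x)"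
    by (simp add: powr_real_of_int')
  have x: "\<bar>x\<bar> = 2 powr log 2 \<bar>x\<bar>"
    using assms by simp
  show "x = sgn x * 2 powi fexp x * signif x"
    by (simp add: signif_def sgn_mult_abs)
  have "2 powi fexp x \<le> \<bar>x\<bar>"
    unfolding eq by (subst x) (simp add: fexp_def)
  then show "1 \<le> signif x"
    by (simp add: signif_def field_simps)
  have "\<bar>x\<bar> < 2 powr (of_int (fexp x) + 1)"
    by (subst x) (simp add: fexp_def)
  then show "signif x < 2"
    by (simp add: signif_def eq powr_add field_simps)
qed

lemma fexp_unique:
  assumes "1 \<le> m" "m < 2" "\<bar>x\<bar> = 2 powi e * m"
  shows "fexp x = e" and "signif x = m"
proof -
  have "log 2 \<bar>x\<bar> = of_int e + log 2 m"
    using assms by (simp add: log_mult log_powr flip: powr_real_of_int')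
  moreover have "0 \<le> log 2 m" "log 2 m < 1"
    using assms by (auto simp: log_less_iff)
  ultimately show *: "fexp x = e"
    unfolding fexp_def by (simp add: floor_eq_iff)
  show "signif x = m"
    using assms by (simp add: signif_def *)
qed

definition ulp :: "nat \<Rightarrow> real \<Rightarrow> real" where
  "ulp p x = 2 powi (fexp x - int p + 1)"

text \<open>
  Keeping the first \<open>q \<ge> 1\<close> bits of the binary expansion of the significand \<open>1.b\<^sub>1b\<^sub>2\<dots>\<close> keeps
  \<open>q - 1\<close> bits after the binary point.
\<close>

definition fl_trunc :: "nat \<Rightarrow> real \<Rightarrow> real" where
  "fl_trunc q x =
     (if x = 0 then 0
      else sgn x * 2 powi fexp x * (of_int \<lfloor>signif x * 2 ^ (q - 1)\<rfloor> / 2 ^ (q - 1)))"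


section \<open>Limited-precision stochastic rounding\<close>

definition sr_prob :: "nat \<Rightarrow> nat \<Rightarrow> real \<Rightarrow> real" where
  "sr_prob p r x = (fl_trunc (p + r) x - fl_down p x) / ulp p x"

text \<open>
  The law of the rounded value of \<open>x\<close>. For \<open>p \<ge> 1\<close> and \<open>x \<noteq> 0\<close> the number \<open>sr_prob p r x\<close> lies in
  \<open>[0,1]\<close>, so the clamping built into \<^const>\<open>bernoulli_pmf\<close> has no effect. If \<open>x\<close> is itself a
  floating-point number, both neighbours coincide with \<open>x\<close> and the law is a point mass.
\<close>

definition SR :: "nat \<Rightarrow> nat \<Rightarrow> real \<Rightarrow> real pmf" where
  "SR p r x =
     (if x = 0 then return_pmf 0
      else map_pmf (\<lambda>up. if up then fl_up p x else fl_down p x) (bernoulli_pmf (sr_prob p r x)))"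


section \<open>Sequences of stochastically rounded operations\<close>

datatype elem_op = Plus | Minus | Times | Divide | Sqrt

fun exact_result :: "elem_op \<Rightarrow> real \<Rightarrow> real \<Rightarrow> real" where
  "exact_result Plus x y = x + y"
| "exact_result Minus x y = x - y"
| "exact_result Times x y = x * y"
| "exact_result Divide x y = x / y"
| "exact_result Sqrt x y = sqrt x"

fun op_defined :: "elem_op \<Rightarrow> real \<Rightarrow> real \<Rightarrow> bool" where
  "op_defined Divide x y \<longleftrightarrow> y \<noteq> 0"
| "op_defined Sqrt x y \<longleftrightarrow> 0 \<le> x"
| "op_defined _ x y \<longleftrightarrow> True"

text \<open>The sub-sigma-algebra generated by the real random variables \<open>X j\<close>, \<open>j \<in> J\<close>.\<close>

definition gen_by :: "'a measure \<Rightarrow> (nat \<Rightarrow> 'a \<Rightarrow> real) \<Rightarrow> nat set \<Rightarrow> 'a measure" where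
  "gen_by M X J = sigma (space M) (\<Union>j\<in>J. {X j -` A \<inter> space M | A. A \<in> sets borel})"

text \<open>
  \<open>Z k\<close> is the rounded and \<open>c k\<close> the exact result of the \<open>k\<close>-th operation \<open>ops k\<close>, whose operands
  \<open>x k\<close> and \<open>y k\<close> are arbitrary functions of the list of the previous rounded results
  \<open>Z 1, \<dots>, Z (k - 1)\<close> (constant functions for deterministic inputs; \<open>y k\<close> is ignored by a square
  root). The last clause states that the conditional distribution of \<open>Z k\<close> given the previous
  rounded results is \<open>SR p r (c k)\<close>.
\<close>

definition sr_sequence ::
  "'a measure \<Rightarrow> nat \<Rightarrow> nat \<Rightarrow> nat \<Rightarrow> (nat \<Rightarrow> elem_op) \<Rightarrow>
   (nat \<Rightarrow> real list \<Rightarrow> real) \<Rightarrow> (nat \<Rightarrow> real list \<Rightarrow> real) \<Rightarrow>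
   (nat \<Rightarrow> 'a \<Rightarrow> real) \<Rightarrow> (nat \<Rightarrow> 'a \<Rightarrow> real) \<Rightarrow> bool" where
  "sr_sequence M p r n ops x y c Z \<longleftrightarrow>
     (\<forall>k\<in>{1..n}.
        Z k \<in> borel_measurable M \<and>
        (\<forall>\<omega>\<in>space M.
           let h = map (\<lambda>j. Z j \<omega>) [1..<k] in
             op_defined (ops k) (x k h) (y k h) \<and>
             c k \<omega> = exact_result (ops k) (x k h) (y k h) \<and>
             Z k \<omega> \<in> {fl_up p (c k \<omega>), fl_down p (c k \<omega>)}) \<and>
        (\<forall>A\<in>sets borel.
           AE \<omega> in M.
             real_cond_exp M (gen_by M Z {1..<k}) (indicator (Z k -` A \<inter> space M)) \<omega> =
             measure_pmf.prob (SR p r (c k \<omega>)) A))"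

end

theory Submission
  imports Defs
begin

text \<open>
  Scale by \<open>ulp p x\<close>: the floats adjacent to a nonzero real \<open>x\<close> become the floor and the ceiling of
  \<open>x / ulp p x\<close> (\<open>fl_down_eq\<close>, \<open>fl_up_eq\<close>), and truncation to \<open>p + r\<close> bits is rounding towards zero on
  a grid that is \<open>2 ^ r\<close> times finer (\<open>fl_trunc_eq\<close>). Hence the truncated value lies between the two
  neighbours of \<open>x\<close>, and the rounding probability makes the mean of the rounded value equal to the
  truncated value (\<open>SR_mean\<close>). In terms of relative errors: \<open>\<alpha>\<^sub>k = \<delta>\<^sub>k - \<beta>\<^sub>k\<close> has
  conditional mean zero given the past, \<open>\<bar>\<alpha>\<^sub>k\<bar> \<le> u p\<close> (\<open>SR_minus_trunc_bound\<close>), and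
  \<open>\<bar>\<beta>\<^sub>k\<bar> \<le> u (p + r)\<close> (\<open>fl_trunc_error\<close>).

  The exact results depend on the past through arbitrary functions, but each step has at most two
  outcomes, so only finitely many histories occur (\<open>finite_hist\<close>). Therefore all quantities are
  measurable, and an event of the past splits into finitely many pieces on which the exact result
  is constant; on each piece the conditional law yields that \<open>\<alpha>\<^sub>k\<close> integrates to zero
  (\<open>integral_err_on_past_event\<close>). As \<open>\<alpha>\<^sub>1, \<dots>, \<alpha>\<^sub>k\<^sub>-\<^sub>1\<close> are determined by the past, this is mean
  independence.

  The product formula is the expansion of \<open>\<Prod>(1 + \<delta>\<^sub>k) = \<Prod>((1 + \<alpha>\<^sub>k) + \<beta>\<^sub>k)\<close> over subsets, with the
  full subset split off (\<open>prod_add_proper_subsets\<close>). Replacing \<open>1 + \<alpha>\<^sub>k\<close> and \<open>\<beta>\<^sub>k\<close> by their bounds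
  \<open>1 + u p\<close> and \<open>u (p + r)\<close> and applying the same expansion backwards gives the bound on the
  remainder.
\<close>

section \<open>Floats and truncation as grids\<close>

lemma u_pos: "0 < u q"
  by (simp add: u_def)

lemma ulp_pos: "0 < ulp p x"
  by (simp add: ulp_def)

lemma ulp_eq:
  assumes "1 \<le> p"
  shows "ulp p x = 2 powi fexp x / 2 ^ (p - 1)"
proof -
  have "fexp x - int p + 1 = fexp x - int (p - 1)"
    using assms by linarith
  then have "ulp p x = 2 powi (fexp x - int (p - 1))"
    by (simp only: ulp_def)
  then show ?thesis
    using power_int_diff[of "2::real" "fexp x" "int (p - 1)"] by simp
qed

lemma fexp_bounds:
  assumes "x \<noteq> 0"
  shows "2 powi fexp x \<le> \<bar>x\<bar>" and "\<bar>x\<bar> < 2 * 2 powi fexp x"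
proof -
  have "(0::real) < 2 powi fexp x" by simp
  then show "2 powi fexp x \<le> \<bar>x\<bar>" "\<bar>x\<bar> < 2 * 2 powi fexp x"
    using fexp_signif(2,3)[OF assms] by (simp_all add: signif_def field_simps)
qed

text \<open>
  Significands in \<open>[1, 2)\<close> correspond to \<open>2 ^ (p - 1) \<le> \<bar>k\<bar> < 2 ^ p\<close>. The endpoint \<open>\<bar>k\<bar> = 2 ^ p\<close> is the
  first float of the next binade; it is needed because rounding away from zero may reach that float.
\<close>

lemma multiple_of_ulp_is_float:
  fixes k :: int
  assumes "1 \<le> p" "2 ^ (p - 1) \<le> \<bar>k\<bar>" "\<bar>k\<bar> \<le> 2 ^ p"
  shows "of_int k * ulp p x \<in> float_system p"
proof -
  define s :: nat where "s = (if k < 0 then 1 else 0)"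
  have s: "s \<in> {0, 1}" "real_of_int k = (-1) ^ s * of_int \<bar>k\<bar>"
    by (auto simp: s_def)
  have p2: "(2::real) ^ p = 2 * 2 ^ (p - 1)"
    using assms(1) by (cases p) auto
  have "\<exists>e m. of_int \<bar>k\<bar> * ulp p x = 2 powi e * m \<and> 1 \<le> m \<and> m < 2 \<and> m * 2 ^ (p - 1) \<in> \<int>"
  proof (cases "\<bar>k\<bar> = 2 ^ p")
    case True
    have "real_of_int \<bar>k\<bar> = 2 ^ p"
      unfolding True by simp
    then have "of_int \<bar>k\<bar> * ulp p x = 2 powi (fexp x + 1) * 1"
      using p2 by (simp add: ulp_eq[OF assms(1)] power_int_add)
    then show ?thesis by (intro exI[of _ "fexp x + 1"] exI[of _ 1]) simp
  next
    case False
    then have "\<bar>k\<bar> < 2 ^ p" using assms by simp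
    then have lt: "real_of_int \<bar>k\<bar> < 2 ^ p"
      by (metis of_int_less_iff of_int_numeral of_int_power)
    have ge: "2 ^ (p - 1) \<le> real_of_int \<bar>k\<bar>"
      using assms(2) by (metis of_int_le_iff of_int_numeral of_int_power)
    have "of_int \<bar>k\<bar> * ulp p x = 2 powi fexp x * (of_int \<bar>k\<bar> / 2 ^ (p - 1))"
      by (simp add: ulp_eq[OF assms(1)])
    moreover have "1 \<le> of_int \<bar>k\<bar> / (2::real) ^ (p - 1)" "of_int \<bar>k\<bar> / (2::real) ^ (p - 1) < 2"
      using lt ge p2 by (auto simp: field_simps)
    moreover have "of_int \<bar>k\<bar> / (2::real) ^ (p - 1) * 2 ^ (p - 1) \<in> \<int>"
      by simp
    ultimately show ?thesis by blast
  qed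
  then obtain e m where em: "of_int \<bar>k\<bar> * ulp p x = 2 powi e * m"
      and m: "1 \<le> m" "m < 2" "m * 2 ^ (p - 1) \<in> \<int>"
    by blast
  have "of_int k * ulp p x = (-1) ^ s * 2 powi e * m"
    unfolding s(2) mult.assoc em ..
  then show ?thesis
    unfolding float_system_def using s(1) m by blast
qed

text \<open>
  Floats at least as large in modulus as the binade of \<open>x\<close> may have larger exponents, but then
  their spacing is a multiple of \<open>ulp p x\<close>.
\<close>

lemma float_is_multiple_of_ulp:
  assumes "1 \<le> p" "y \<in> float_system p" "2 powi fexp x \<le> \<bar>y\<bar>"
  obtains k :: int where "y = of_int k * ulp p x"
proof -
  have "(0::real) < 2 powi fexp x" by simp
  then have "y \<noteq> 0" using assms(3) by linarith
  then obtain s :: nat and e :: int and m :: real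
    where y: "y = (-1) ^ s * 2 powi e * m" "1 \<le> m" "m < 2" "m * 2 ^ (p - 1) \<in> \<int>"
    using assms(2) by (auto simp: float_system_def)
  from y(4) obtain j :: int where j: "m * 2 ^ (p - 1) = of_int j"
    by (auto elim: Ints_cases)
  have "\<bar>y\<bar> < 2 powi (e + 1)"
    using y by (simp add: abs_mult power_abs power_int_add)
  with assms(3) have "(2::real) powi fexp x < 2 powi (e + 1)"
    by linarith
  then have le: "fexp x \<le> e"
    using power_int_increasing[of "e + 1" "fexp x" "2::real"] by linarith
  have "(2::real) powi e = 2 powi (int (nat (e - fexp x)) + fexp x)"
    using le by simp
  also have "\<dots> = 2 ^ nat (e - fexp x) * 2 powi fexp x"
    by (subst power_int_add) (simp_all only: power_int_of_nat, simp)
  finally have e: "(2::real) powi e = 2 ^ nat (e - fexp x) * 2 powi fexp x" .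
  have "y = (-1) ^ s * 2 ^ nat (e - fexp x) * (m * 2 ^ (p - 1)) * ulp p x"
    unfolding y(1) e ulp_eq[OF assms(1)] by simp
  also have "\<dots> = of_int ((-1) ^ s * 2 ^ nat (e - fexp x) * j) * ulp p x"
    unfolding j by simp
  finally show ?thesis by (rule that)
qed

lemma scaled_bounds:
  assumes "1 \<le> p" "x \<noteq> 0"
  shows "2 ^ (p - 1) \<le> \<bar>x / ulp p x\<bar>" "\<bar>x / ulp p x\<bar> < 2 ^ p"
proof -
  have p2: "(2::real) ^ p = 2 * 2 ^ (p - 1)"
    using assms(1) by (cases p) auto
  have "(0::real) < 2 powi fexp x" by simp
  then show "2 ^ (p - 1) \<le> \<bar>x / ulp p x\<bar>" "\<bar>x / ulp p x\<bar> < 2 ^ p"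
    using fexp_bounds[OF assms(2)] p2
    by (simp_all add: ulp_eq[OF assms(1)] abs_mult field_simps)
qed

text \<open>
  The grid of spacing \<open>ulp p x\<close> and the floats have the same greatest element below \<open>x\<close>, although
  there are floats outside the grid: these are smaller in modulus than the binade of \<open>x\<close>.
\<close>

lemma greatest_float_below:
  assumes "1 \<le> p" "x \<noteq> 0"
  shows "of_int \<lfloor>x / ulp p x\<rfloor> * ulp p x \<in> float_system p"
    and "of_int \<lfloor>x / ulp p x\<rfloor> * ulp p x \<le> x"
    and "y \<in> float_system p \<Longrightarrow> y \<le> x \<Longrightarrow> y \<le> of_int \<lfloor>x / ulp p x\<rfloor> * ulp p x"
proof -
  let ?s = "ulp p x"
  have s: "0 < ?s" by (rule ulp_pos)
  have b: "(of_int (2 ^ (p - 1)) :: real) \<le> \<bar>x / ?s\<bar>" "\<bar>x / ?s\<bar> < of_int (2 ^ p)"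
    using scaled_bounds[OF assms] by simp_all
  have "2 ^ (p - 1) \<le> \<bar>\<lfloor>x / ?s\<rfloor>\<bar> \<and> \<bar>\<lfloor>x / ?s\<rfloor>\<bar> \<le> 2 ^ p"
  proof (cases "0 \<le> x / ?s")
    case True
    then have "2 ^ (p - 1) \<le> \<lfloor>x / ?s\<rfloor>" "\<lfloor>x / ?s\<rfloor> < 2 ^ p"
      using b by (simp_all only: le_floor_iff floor_less_iff abs_of_nonneg)
    moreover have "0 \<le> \<lfloor>x / ?s\<rfloor>" using True by simp
    ultimately show ?thesis by simp
  next
    case False
    then have "of_int (- (2 ^ p)) \<le> x / ?s"
      using b(2) by (simp only: of_int_minus)
    then have "- (2 ^ p) \<le> \<lfloor>x / ?s\<rfloor>"
      by (simp only: le_floor_iff)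
    moreover have "x / ?s \<le> of_int (- (2 ^ (p - 1)))"
      using b(1) False by (simp only: of_int_minus)
    then have "\<lfloor>x / ?s\<rfloor> \<le> - (2 ^ (p - 1))"
      by (simp only: floor_le_iff)
    moreover have "\<lfloor>x / ?s\<rfloor> < 0" using False by simp
    ultimately show ?thesis by linarith
  qed
  then show "of_int \<lfloor>x / ?s\<rfloor> * ?s \<in> float_system p"
    using multiple_of_ulp_is_float[OF assms(1)] by blast
  show "of_int \<lfloor>x / ?s\<rfloor> * ?s \<le> x"
    using s by (metis of_int_floor_le pos_le_divide_eq)
  assume y: "y \<in> float_system p" "y \<le> x"
  show "y \<le> of_int \<lfloor>x / ?s\<rfloor> * ?s"
  proof (cases "2 powi fexp x \<le> \<bar>y\<bar>")
    case True
    then obtain k :: int where k: "y = of_int k * ?s"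
      using float_is_multiple_of_ulp assms(1) y by blast
    then have "of_int k \<le> x / ?s" using y s by (simp add: field_simps)
    then have "k \<le> \<lfloor>x / ?s\<rfloor>" by (simp add: le_floor_iff)
    then show ?thesis unfolding k using s by simp
  next
    case False
    \<comment> \<open>A float \<open>y \<le> x\<close> smaller in modulus than the binade of \<open>x\<close> exists only for positive \<open>x\<close>,
      and then the lower end of the binade, a grid point, separates the two.\<close>
    have "0 < x" using False y fexp_bounds(1)[OF assms(2)] by linarith
    then have "of_int (2 ^ (p - 1)) \<le> x / ?s" using b s by simp
    then have "2 ^ (p - 1) \<le> \<lfloor>x / ?s\<rfloor>" by (simp only: le_floor_iff)
    then have "real_of_int (2 ^ (p - 1)) * ?s \<le> of_int \<lfloor>x / ?s\<rfloor> * ?s"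
      using s by (simp only: mult_le_cancel_right_pos of_int_le_iff)
    moreover have "real_of_int (2 ^ (p - 1)) * ?s = 2 powi fexp x"
      by (simp add: ulp_eq[OF assms(1)])
    ultimately show ?thesis using False by linarith
  qed
qed

lemma fl_down_eq:
  assumes "1 \<le> p" "x \<noteq> 0"
  shows "fl_down p x = of_int \<lfloor>x / ulp p x\<rfloor> * ulp p x"
  unfolding fl_down_def
proof (rule Greatest_equality)
  show "of_int \<lfloor>x / ulp p x\<rfloor> * ulp p x \<in> float_system p \<and>
      of_int \<lfloor>x / ulp p x\<rfloor> * ulp p x \<le> x"
    using greatest_float_below(1,2)[OF assms] by (rule conjI)
  show "y \<le> of_int \<lfloor>x / ulp p x\<rfloor> * ulp p x" if "y \<in> float_system p \<and> y \<le> x" for y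
    using that greatest_float_below(3)[OF assms] by blast
qed

lemma uminus_float_system: "- y \<in> float_system p \<longleftrightarrow> y \<in> float_system p"
proof -
  have "- y \<in> float_system p" if y: "y \<in> float_system p" for y
  proof (cases "y = 0")
    case False
    then obtain s e m where s: "s \<in> {0, 1::nat}"
      and m: "1 \<le> m" "m < 2" "m * 2 ^ (p - 1) \<in> \<int>" "y = (-1) ^ s * 2 powi e * m"
      using y by (auto simp: float_system_def)
    have "- y = (-1) ^ (1 - s) * 2 powi e * m" "1 - s \<in> {0, 1}"
      using s m by auto
    then show ?thesis unfolding float_system_def using m(1-3) by blast
  qed (simp add: float_system_def)
  from this[of y] this[of "- y"] show ?thesis by auto
qed

lemma fl_up_eq:
  assumes "1 \<le> p" "x \<noteq> 0"
  shows "fl_up p x = of_int \<lceil>x / ulp p x\<rceil> * ulp p x"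
proof -
  \<comment> \<open>The float system is symmetric, so this is the reflection of rounding \<open>- x\<close> downwards.\<close>
  let ?g = "of_int \<lfloor>- x / ulp p (- x)\<rfloor> * ulp p (- x)"
  have g: "of_int \<lceil>x / ulp p x\<rceil> * ulp p x = - ?g"
    by (simp add: ceiling_def ulp_def fexp_def)
  have "- x \<noteq> 0" using assms(2) by simp
  note below = greatest_float_below[OF assms(1) this]
  show ?thesis
    unfolding fl_up_def g
  proof (rule Least_equality)
    show "- ?g \<in> float_system p \<and> x \<le> - ?g"
      using below(1,2) uminus_float_system by (metis le_minus_iff)
    fix y assume "y \<in> float_system p \<and> x \<le> y"
    then show "- ?g \<le> y"
      using below(3)[of "- y"] uminus_float_system[of y p] by simp
  qed
qed

lemma fl_trunc_eq:
  assumes "1 \<le> q" "x \<noteq> 0"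
  shows "fl_trunc q x = of_int (if 0 < x then \<lfloor>x / ulp q x\<rfloor> else \<lceil>x / ulp q x\<rceil>) * ulp q x"
proof -
  have "signif x * 2 ^ (q - 1) = \<bar>x\<bar> / ulp q x"
    by (simp add: signif_def ulp_eq[OF assms(1)])
  then show ?thesis
    using assms by (simp add: fl_trunc_def ulp_eq[OF assms(1)] ceiling_def sgn_if)
qed

lemma ulp_eq_power_mult_ulp:
  assumes "1 \<le> p"
  shows "ulp p x = 2 ^ r * ulp (p + r) x"
proof -
  have "(2::real) ^ (p + r - 1) = 2 ^ (p - 1) * 2 ^ r"
    using assms by (simp flip: power_add)
  then show ?thesis
    using assms by (simp add: ulp_eq)
qed

lemma ulp_le:
  assumes "1 \<le> p" "x \<noteq> 0"
  shows "ulp p x \<le> u p * \<bar>x\<bar>"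
proof -
  have "1 - int p = - int (p - 1)" using assms(1) by linarith
  then have "u p = 2 powi (- int (p - 1))" by (simp only: u_def)
  then have "u p = 1 / 2 ^ (p - 1)" by (simp add: power_int_minus field_simps)
  then show ?thesis
    using fexp_bounds(1)[OF assms(2)] by (simp add: ulp_eq[OF assms(1)] divide_right_mono)
qed

lemma fl_trunc_error:
  assumes "1 \<le> q" "x \<noteq> 0"
  shows "\<bar>fl_trunc q x - x\<bar> \<le> u q * \<bar>x\<bar>"
proof -
  let ?t = "ulp q x" and ?k = "if 0 < x then \<lfloor>x / ulp q x\<rfloor> else \<lceil>x / ulp q x\<rceil>"
  have t: "0 < ?t" by (rule ulp_pos)
  have "fl_trunc q x - x = (of_int ?k - x / ?t) * ?t"
    using t by (simp add: fl_trunc_eq[OF assms] left_diff_distrib del: of_int_eq_iff)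
  moreover have "\<bar>of_int ?k - x / ?t\<bar> \<le> 1"
    by (cases "0 < x") (simp_all only: if_True if_False, linarith+)
  ultimately have "\<bar>fl_trunc q x - x\<bar> \<le> 1 * ?t"
    using t by (simp only: abs_mult abs_of_pos mult_right_mono order.strict_implies_order)
  then show ?thesis using ulp_le[OF assms] by simp
qed

text \<open>
  The grid of spacing \<open>ulp p x\<close> is contained in the grid of spacing \<open>ulp (p + r) x\<close>, so truncation
  to the finer grid cannot cross a point of the coarser one.
\<close>

lemma fl_trunc_between:
  assumes "1 \<le> p" "x \<noteq> 0"
  shows "fl_down p x \<le> fl_trunc (p + r) x" "fl_trunc (p + r) x \<le> fl_up p x"
proof -
  let ?t = "ulp (p + r) x"
  have t: "0 < ?t" by (rule ulp_pos)
  have q: "1 \<le> p + r" using assms by simp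
  define a :: int where "a = \<lfloor>x / ulp p x\<rfloor> * 2 ^ r"
  define b :: int where "b = \<lceil>x / ulp p x\<rceil> * 2 ^ r"
  have d: "fl_down p x = of_int a * ?t"
    using fl_down_eq[OF assms] by (simp add: a_def ulp_eq_power_mult_ulp[OF assms(1)])
  have e: "fl_up p x = of_int b * ?t"
    using fl_up_eq[OF assms] by (simp add: b_def ulp_eq_power_mult_ulp[OF assms(1)])
  have "of_int a * ?t \<le> x" "x \<le> of_int b * ?t"
    unfolding d[symmetric] e[symmetric] fl_down_eq[OF assms] fl_up_eq[OF assms]
    using ulp_pos[of p x]
    by (metis of_int_floor_le pos_le_divide_eq, metis le_of_int_ceiling pos_divide_le_eq)
  then have "of_int a \<le> x / ?t" "x / ?t \<le> of_int b"
    using t by (simp_all add: field_simps)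
  then have "a \<le> \<lfloor>x / ?t\<rfloor>" "\<lceil>x / ?t\<rceil> \<le> b"
    by (simp_all add: le_floor_iff ceiling_le_iff)
  moreover from this have "a \<le> \<lceil>x / ?t\<rceil>" "\<lfloor>x / ?t\<rfloor> \<le> b"
    using floor_le_ceiling[of "x / ?t"] by linarith+
  ultimately have "a \<le> (if 0 < x then \<lfloor>x / ?t\<rfloor> else \<lceil>x / ?t\<rceil>)"
    "(if 0 < x then \<lfloor>x / ?t\<rfloor> else \<lceil>x / ?t\<rceil>) \<le> b"
    by auto
  then show "fl_down p x \<le> fl_trunc (p + r) x" "fl_trunc (p + r) x \<le> fl_up p x"
    unfolding d e fl_trunc_eq[OF q assms(2)] using t
    by (simp_all only: mult_le_cancel_right_pos of_int_le_iff)
qed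

lemma fl_up_minus_fl_down:
  assumes "1 \<le> p" "x \<noteq> 0"
  shows "fl_up p x = fl_down p x \<or> fl_up p x - fl_down p x = ulp p x"
proof -
  have "\<lceil>x / ulp p x\<rceil> = \<lfloor>x / ulp p x\<rfloor> \<or> \<lceil>x / ulp p x\<rceil> = \<lfloor>x / ulp p x\<rfloor> + 1"
    by (simp add: ceiling_altdef)
  then show ?thesis
    unfolding fl_up_eq[OF assms] fl_down_eq[OF assms] by (auto simp: algebra_simps)
qed

section \<open>Mean and spread of stochastic rounding\<close>

text \<open>
  Stochastic rounding with \<open>r\<close> bits is an unbiased estimate of the truncation of \<open>x\<close> to \<open>p + r\<close> bits,
  not of \<open>x\<close> itself. The weight \<open>w\<close> is the probability of the event that the rounded value equals
  \<open>fl_up p x\<close>; it is \<open>1\<close> if \<open>x\<close> is a float, and \<open>sr_prob p r x\<close> otherwise.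
\<close>

lemma SR_mean:
  fixes p r :: nat and x :: real
  assumes "1 \<le> p" "x \<noteq> 0"
  defines "w \<equiv> measure_pmf.prob (SR p r x) {fl_up p x}"
  shows "w * fl_up p x + (1 - w) * fl_down p x = fl_trunc (p + r) x"
proof (cases "fl_up p x = fl_down p x")
  case True
  then show ?thesis
    using fl_trunc_between[OF assms(1,2), of r] by (simp add: algebra_simps)
next
  case False
  then have s: "fl_up p x - fl_down p x = ulp p x"
    using fl_up_minus_fl_down[OF assms(1,2)] by simp
  have pos: "0 < ulp p x" by (rule ulp_pos)
  have "0 \<le> sr_prob p r x" "sr_prob p r x \<le> 1"
    using fl_trunc_between[OF assms(1,2), of r] s pos by (simp_all add: sr_prob_def)
  moreover have "(\<lambda>up. if up then fl_up p x else fl_down p x) -` {fl_up p x} = {True}"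
    using False by (auto split: if_splits)
  ultimately have "w = sr_prob p r x"
    using assms(2) by (simp add: w_def SR_def measure_pmf_single pmf_map)
  then have "w * (fl_up p x - fl_down p x) = fl_trunc (p + r) x - fl_down p x"
    using pos by (simp add: s sr_prob_def)
  then show ?thesis by (simp add: algebra_simps)
qed

text \<open>
  The rounded and the truncated value lie between the neighbours of \<open>x\<close>, so their distance is at
  most one \<open>ulp\<close>; a triangle inequality through \<open>x\<close> would give the weaker bound
  \<open>u p + u (p + r)\<close>.
\<close>

lemma SR_minus_trunc_bound:
  assumes "1 \<le> p" "x \<noteq> 0" "z \<in> {fl_up p x, fl_down p x}"
  shows "\<bar>(z - fl_trunc (p + r) x) / x\<bar> \<le> u p"
proof -
  have "\<bar>z - fl_trunc (p + r) x\<bar> \<le> fl_up p x - fl_down p x"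
    using fl_trunc_between[OF assms(1,2), of r] assms(3) by auto
  also have "\<dots> \<le> ulp p x"
    using fl_up_minus_fl_down[OF assms(1,2)] ulp_pos[of p x] by auto
  also have "\<dots> \<le> u p * \<bar>x\<bar>"
    by (rule ulp_le[OF assms(1,2)])
  finally show ?thesis using assms(2) by (simp add: field_simps)
qed

section \<open>Expanding a product of sums\<close>

lemma prod_add_proper_subsets:
  fixes a b :: "'i \<Rightarrow> 'b::comm_semiring_1"
  assumes "finite I"
  shows "(\<Prod>k\<in>I. a k + b k) =
    (\<Prod>k\<in>I. a k) + (\<Sum>K | K \<subseteq> I \<and> K \<noteq> I. (\<Prod>l\<in>K. a l) * (\<Prod>j\<in>I - K. b j))"
proof -
  have "Pow I = insert I {K. K \<subseteq> I \<and> K \<noteq> I}" by auto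
  moreover have "finite {K. K \<subseteq> I \<and> K \<noteq> I}"
    using assms by (auto intro: finite_subset[of _ "Pow I"])
  ultimately show ?thesis
    using prod_add[OF assms, of a b] by simp
qed

lemma proper_subset_sum_bound:
  fixes a b :: "'i \<Rightarrow> real"
  assumes "finite I" "\<And>k. k \<in> I \<Longrightarrow> \<bar>a k\<bar> \<le> s" "\<And>k. k \<in> I \<Longrightarrow> \<bar>b k\<bar> \<le> t"
  shows "\<bar>\<Sum>K | K \<subseteq> I \<and> K \<noteq> I. (\<Prod>l\<in>K. a l) * (\<Prod>j\<in>I - K. b j)\<bar> \<le> (s + t) ^ card I - s ^ card I"
proof -
  let ?P = "{K. K \<subseteq> I \<and> K \<noteq> I}"
  have "\<bar>\<Sum>K\<in>?P. (\<Prod>l\<in>K. a l) * (\<Prod>j\<in>I - K. b j)\<bar> \<le> (\<Sum>K\<in>?P. (\<Prod>l\<in>K. s) * (\<Prod>j\<in>I - K. t))"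
  proof (rule order_trans[OF sum_abs sum_mono])
    fix K assume K: "K \<in> ?P"
    have *: "\<bar>\<Prod>l\<in>K. a l\<bar> \<le> (\<Prod>l\<in>K. s)" "\<bar>\<Prod>j\<in>I - K. b j\<bar> \<le> (\<Prod>j\<in>I - K. t)"
      unfolding abs_prod using K assms by (blast intro: prod_mono abs_ge_zero)+
    show "\<bar>(\<Prod>l\<in>K. a l) * (\<Prod>j\<in>I - K. b j)\<bar> \<le> (\<Prod>l\<in>K. s) * (\<Prod>j\<in>I - K. t)"
      unfolding abs_mult by (rule mult_mono[OF * order_trans[OF abs_ge_zero *(1)] abs_ge_zero])
  qed
  also have "\<dots> = (s + t) ^ card I - s ^ card I"
    using prod_add_proper_subsets[OF assms(1), of "\<lambda>_. s" "\<lambda>_. t"] by simp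
  finally show ?thesis .
qed

section \<open>Sigma-algebras generated by random variables\<close>

lemma space_gen_by [simp]: "space (gen_by M X J) = space M"
  unfolding gen_by_def by (rule space_measure_of) blast

lemma measurable_gen_by:
  assumes "j \<in> J"
  shows "X j \<in> borel_measurable (gen_by M X J)"
proof (rule measurableI)
  fix A :: "real set" assume "A \<in> sets borel"
  then have "X j -` A \<inter> space M \<in> (\<Union>j\<in>J. {X j -` A \<inter> space M | A. A \<in> sets borel})"
    using assms by blast
  then show "X j -` A \<inter> space (gen_by M X J) \<in> sets (gen_by M X J)"
    unfolding space_gen_by unfolding gen_by_def by (intro in_measure_of) blast
qed simp

lemma sets_gen_by_subset:
  assumes "space N = space M" "\<And>j. j \<in> J \<Longrightarrow> X j \<in> borel_measurable N"
  shows "sets (gen_by M X J) \<subseteq> sets N"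
proof -
  have "(\<Union>j\<in>J. {X j -` A \<inter> space M | A. A \<in> sets borel}) \<subseteq> sets N"
    using assms measurable_sets by (fastforce simp flip: assms(1))
  then show ?thesis
    unfolding gen_by_def assms(1)[symmetric]
    by (subst sets_measure_of) (auto dest: sets.sets_into_space intro!: sets.sigma_sets_subset)
qed

lemma (in prob_space) real_cond_exp_eq_0:
  assumes "subalgebra M F" "integrable M f"
    and "\<And>G. G \<in> sets F \<Longrightarrow> (\<integral>\<omega>. indicator G \<omega> * f \<omega> \<partial>M) = 0"
  shows "AE \<omega> in M. real_cond_exp M F f \<omega> = 0"
proof -
  interpret finite_measure_subalgebra M F by unfold_locales fact
  show ?thesis
    by (rule real_cond_exp_charact) (use assms in \<open>auto simp: set_lebesgue_integral_def\<close>)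
qed

section \<open>Mean independence of the centred errors\<close>

text \<open>
  A sequence of \<open>n\<close> operations with stochastic rounding on a probability space. The steps are
  numbered from \<open>1\<close>.
\<close>

locale sr_process = prob_space M
  for M :: "'a measure" +
  fixes p r n :: nat and ops :: "nat \<Rightarrow> elem_op" and x y :: "nat \<Rightarrow> real list \<Rightarrow> real"
    and c Z :: "nat \<Rightarrow> 'a \<Rightarrow> real"
  assumes p: "1 \<le> p" and seq: "sr_sequence M p r n ops x y c Z"
begin

text \<open>The list of rounded results preceding step \<open>k\<close>; the operands of step \<open>k\<close> are functions of it.\<close>

definition hist :: "nat \<Rightarrow> 'a \<Rightarrow> real list" where
  "hist k \<omega> = map (\<lambda>j. Z j \<omega>) [1..<k]"

text \<open>The sigma-algebra generated by the rounded results preceding step \<open>k\<close>.\<close>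

abbreviation past :: "nat \<Rightarrow> 'a measure" where
  "past k \<equiv> gen_by M Z {1..<k}"

text \<open>
  The relative deviation of the rounded result from the truncated one. It equals \<open>\<delta>\<^sub>k - \<beta>\<^sub>k\<close>, also if
  \<open>c k \<omega> = 0\<close>, since division by zero yields \<open>0\<close>.
\<close>

definition err :: "nat \<Rightarrow> 'a \<Rightarrow> real" where
  "err k \<omega> = (Z k \<omega> - fl_trunc (p + r) (c k \<omega>)) / c k \<omega>"

lemma measurable_Z: "k \<in> {1..n} \<Longrightarrow> Z k \<in> borel_measurable M"
  using seq by (simp add: sr_sequence_def)

lemma c_hist:
  assumes "k \<in> {1..n}"
  obtains g where "\<And>\<omega>. \<omega> \<in> space M \<Longrightarrow> c k \<omega> = g (hist k \<omega>)"
proof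
  show "c k \<omega> = exact_result (ops k) (x k (hist k \<omega>)) (y k (hist k \<omega>))" if "\<omega> \<in> space M" for \<omega>
    using seq assms that unfolding sr_sequence_def Let_def hist_def by blast
qed

lemma Z_neighbour:
  assumes "k \<in> {1..n}" "\<omega> \<in> space M"
  shows "Z k \<omega> \<in> {fl_up p (c k \<omega>), fl_down p (c k \<omega>)}"
  using seq assms unfolding sr_sequence_def Let_def by blast

lemma cond_law:
  assumes "k \<in> {1..n}" "A \<in> sets borel"
  shows "AE \<omega> in M. real_cond_exp M (past k) (indicator (Z k -` A \<inter> space M)) \<omega> =
           measure_pmf.prob (SR p r (c k \<omega>)) A"
  using seq assms unfolding sr_sequence_def by blast

text \<open>
  Each step at most doubles the number of histories. Finiteness makes every function of the
  history measurable, although the operand functions are arbitrary.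
\<close>

lemma finite_hist: "k \<le> n + 1 \<Longrightarrow> finite (hist k ` space M)"
proof (induction k)
  case 0
  show ?case by (rule finite_subset[of _ "{[]}"]) (auto simp: hist_def)
next
  case (Suc k)
  show ?case
  proof (cases "k = 0")
    case True
    then show ?thesis by - (rule finite_subset[of _ "{[]}"], auto simp: hist_def)
  next
    case False
    then have k: "k \<in> {1..n}" using Suc.prems by simp
    obtain g where g: "\<And>\<omega>. \<omega> \<in> space M \<Longrightarrow> c k \<omega> = g (hist k \<omega>)"
      using c_hist[OF k] by blast
    have "hist (Suc k) ` space M \<subseteq>
        (\<lambda>h. h @ [fl_up p (g h)]) ` hist k ` space M \<union> (\<lambda>h. h @ [fl_down p (g h)]) ` hist k ` space M"
    proof
      fix l assume "l \<in> hist (Suc k) ` space M"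
      then obtain \<omega> where \<omega>: "\<omega> \<in> space M" "l = hist (Suc k) \<omega>" by blast
      have "l = hist k \<omega> @ [Z k \<omega>]" using False \<omega>(2) by (simp add: hist_def)
      with Z_neighbour[OF k \<omega>(1)] g[OF \<omega>(1)] \<omega>(1)
      show "l \<in> (\<lambda>h. h @ [fl_up p (g h)]) ` hist k ` space M \<union> (\<lambda>h. h @ [fl_down p (g h)]) ` hist k ` space M"
        by auto
    qed
    then show ?thesis
      by (rule finite_subset) (use Suc in auto)
  qed
qed

lemma measurable_hist:
  assumes "j \<le> k" "k \<le> n + 1"
  shows "hist j \<in> measurable (past k) (count_space (hist j ` space M))"
proof -
  have "hist j -` {hist j \<omega>0} \<inter> space (past k) \<in> sets (past k)" for \<omega>0
  proof -
    have "hist j -` {hist j \<omega>0} \<inter> space (past k) =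
        {\<omega> \<in> space (past k). \<forall>i\<in>{1..<j}. Z i \<omega> = Z i \<omega>0}"
      by (auto simp: hist_def)
    also have "\<dots> \<in> sets (past k)"
    proof (rule sets.sets_Collect_finite_All)
      fix i assume "i \<in> {1..<j}"
      then have [measurable]: "Z i \<in> borel_measurable (past k)"
        using assms by (intro measurable_gen_by) simp
      show "{\<omega> \<in> space (past k). Z i \<omega> = Z i \<omega>0} \<in> sets (past k)"
        by measurable
    qed simp
    finally show ?thesis .
  qed
  moreover have "countable (hist j ` space M)"
    using finite_hist assms by (simp add: countable_finite)
  ultimately show ?thesis
    by (subst measurable_count_space_eq_countable) auto
qed

lemma measurable_exact:
  fixes f :: "real \<Rightarrow> real"
  assumes "j \<in> {1..n}" "j \<le> k" "k \<le> n + 1"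
  shows "(\<lambda>\<omega>. f (c j \<omega>)) \<in> borel_measurable (past k)"
proof -
  obtain g where g: "\<And>\<omega>. \<omega> \<in> space M \<Longrightarrow> c j \<omega> = g (hist j \<omega>)"
    using c_hist[OF assms(1)] by blast
  have "(\<lambda>\<omega>. f (g (hist j \<omega>))) \<in> borel_measurable (past k)"
    by (rule measurable_compose[OF measurable_hist[OF assms(2,3)]]) simp
  then show ?thesis
    by (subst measurable_cong[where g = "\<lambda>\<omega>. f (g (hist j \<omega>))"]) (simp_all add: g)
qed

lemma finite_exact:
  assumes "k \<in> {1..n}"
  shows "finite (c k ` space M)"
proof -
  obtain g where g: "\<And>\<omega>. \<omega> \<in> space M \<Longrightarrow> c k \<omega> = g (hist k \<omega>)"
    using c_hist[OF assms(1)] by blast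
  then have "c k ` space M = g ` hist k ` space M" by force
  then show ?thesis using finite_hist[of k] assms by simp
qed

lemma subalgebra_past:
  assumes "k \<le> n + 1"
  shows "subalgebra M (past k)"
  unfolding subalgebra_def
proof
  show "sets (past k) \<subseteq> sets M"
    using assms by (intro sets_gen_by_subset measurable_Z) auto
qed simp

lemma measurable_err:
  assumes "j \<in> {1..n}" "j < k" "k \<le> n + 1"
  shows "err j \<in> borel_measurable (past k)"
proof -
  have [measurable]: "Z j \<in> borel_measurable (past k)"
    using assms by (intro measurable_gen_by) simp
  have [measurable]: "(\<lambda>\<omega>. fl_trunc (p + r) (c j \<omega>)) \<in> borel_measurable (past k)"
      "c j \<in> borel_measurable (past k)"
    using assms measurable_exact[of j k] measurable_exact[of j k "\<lambda>v. v"] by simp_all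
  show ?thesis unfolding err_def by measurable
qed

lemma err_bound:
  assumes "k \<in> {1..n}" "\<omega> \<in> space M"
  shows "\<bar>err k \<omega>\<bar> \<le> u p"
proof (cases "c k \<omega> = 0")
  case True
  then show ?thesis using u_pos[of p] by (simp add: err_def)
next
  case False
  show ?thesis
    unfolding err_def by (rule SR_minus_trunc_bound[OF p False Z_neighbour[OF assms]])
qed

lemma integrable_err:
  assumes "k \<in> {1..n}"
  shows "integrable M (err k)"
proof (rule integrable_const_bound[of _ "u p"])
  show "err k \<in> borel_measurable M"
    using assms by (intro measurable_from_subalg[OF subalgebra_past measurable_err[of k "Suc k"]]) auto
qed (use err_bound[OF assms] in \<open>auto intro: AE_I2\<close>)

text \<open>
  Where the exact result is a constant \<open>v\<close>, the rounded result takes the two fixed values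
  \<open>fl_up p v\<close> and \<open>fl_down p v\<close>, so the conditional law enters only through the probability of the
  single event \<open>Z k = fl_up p v\<close>.
\<close>

lemma integral_err_on_fibre:
  assumes k: "k \<in> {1..n}" and H: "H \<in> sets (past k)" and v: "\<And>\<omega>. \<omega> \<in> H \<Longrightarrow> c k \<omega> = v"
  shows "(\<integral>\<omega>. indicator H \<omega> * err k \<omega> \<partial>M) = 0"
proof (cases "v = 0")
  case True
  then have "(\<lambda>\<omega>. indicator H \<omega> * err k \<omega>) = (\<lambda>_. 0)"
    using v by (auto simp: err_def indicator_def)
  then show ?thesis by simp
next
  case False
  have k': "k \<le> n + 1" using k by simp
  interpret finite_measure_subalgebra M "past k"
    by unfold_locales (rule subalgebra_past[OF k'])
  have HM[measurable]: "H \<in> sets M"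
    using H subalgebra_past[OF k'] by (auto simp: subalgebra_def)
  have [measurable]: "Z k \<in> borel_measurable M" by (rule measurable_Z[OF k])
  have Hs: "H \<subseteq> space M" using HM by (rule sets.sets_into_space)
  define E where "E = Z k -` {fl_up p v} \<inter> space M"
  have E[measurable]: "E \<in> sets M" unfolding E_def by measurable
  define w where "w = measure_pmf.prob (SR p r v) {fl_up p v}"
  define a where "a = (fl_up p v - fl_trunc (p + r) v) / v"
  define b where "b = (fl_down p v - fl_trunc (p + r) v) / v"
  have int: "integrable M (\<lambda>\<omega>. indicator H \<omega> * indicator E \<omega> :: real)"
    by (rule integrable_const_bound[of _ 1]) (auto simp: indicator_def)
  have intH: "integrable M (indicator H :: 'a \<Rightarrow> real)"
    by (rule integrable_const_bound[of _ 1]) (auto simp: indicator_def)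
  have "(\<integral>\<omega>. indicator H \<omega> * indicator E \<omega> \<partial>M) =
      (\<integral>\<omega>. indicator H \<omega> * real_cond_exp M (past k) (indicator E) \<omega> \<partial>M)"
    by (rule real_cond_exp_intg(2)[symmetric, OF int]) (use H in auto)
  also have "\<dots> = (\<integral>\<omega>. w * indicator H \<omega> \<partial>M)"
  proof (rule integral_cong_AE)
    show "AE \<omega> in M. indicator H \<omega> * real_cond_exp M (past k) (indicator E) \<omega> = w * indicator H \<omega>"
      using cond_law[OF k, of "{fl_up p v}"] v unfolding E_def[symmetric]
      by (auto simp: indicator_def w_def)
  qed auto
  finally have hit: "(\<integral>\<omega>. indicator H \<omega> * indicator E \<omega> \<partial>M) = w * prob H"
    by simp
  have "indicator H \<omega> * err k \<omega> = (a - b) * (indicator H \<omega> * indicator E \<omega>) + b * indicator H \<omega>" for \<omega>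
  proof (cases "\<omega> \<in> H")
    case True
    then have \<omega>: "\<omega> \<in> space M" using Hs by blast
    show ?thesis
      using Z_neighbour[OF k \<omega>] \<omega> True v[OF True]
      by (auto simp: err_def E_def a_def b_def indicator_def)
  qed simp
  then have "(\<integral>\<omega>. indicator H \<omega> * err k \<omega> \<partial>M) =
      (\<integral>\<omega>. (a - b) * (indicator H \<omega> * indicator E \<omega>) + b * indicator H \<omega> \<partial>M)"
    by simp
  also have "\<dots> = (a - b) * (w * prob H) + b * prob H"
    using int intH hit by (subst Bochner_Integration.integral_add) auto
  also have "\<dots> = (w * a + (1 - w) * b) * prob H"
    by (simp add: algebra_simps)
  also have "w * a + (1 - w) * b = (w * fl_up p v + (1 - w) * fl_down p v - fl_trunc (p + r) v) / v"
    using False by (simp add: a_def b_def field_simps)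
  also have "\<dots> = 0"
    using SR_mean[OF p False, of r] by (simp add: w_def)
  finally show ?thesis by simp
qed

lemma integral_err_on_past_event:
  assumes k: "k \<in> {1..n}" and G: "G \<in> sets (past k)"
  shows "(\<integral>\<omega>. indicator G \<omega> * err k \<omega> \<partial>M) = 0"
proof -
  define H where "H v = G \<inter> {\<omega> \<in> space M. c k \<omega> = v}" for v
  have [measurable]: "c k \<in> borel_measurable (past k)"
    using k measurable_exact[of k k "\<lambda>v. v"] by simp
  have "{\<omega> \<in> space (past k). c k \<omega> = v} \<in> sets (past k)" for v
    by measurable
  then have H: "H v \<in> sets (past k)" for v
    using G by (simp add: H_def)
  have HM: "H v \<in> sets M" for v
    using H[of v] subalgebra_past[of k] k by (auto simp: subalgebra_def)
  have fin: "finite (c k ` space M)" by (rule finite_exact[OF k])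
  have "indicator G \<omega> * err k \<omega> = (\<Sum>v\<in>c k ` space M. indicator (H v) \<omega> * err k \<omega>)"
    if \<omega>: "\<omega> \<in> space M" for \<omega>
  proof -
    have "(\<Sum>v\<in>c k ` space M. indicator (H v) \<omega> * err k \<omega>) =
        (\<Sum>v\<in>c k ` space M. if c k \<omega> = v then indicator G \<omega> * err k \<omega> else 0)"
      using \<omega> by (intro sum.cong) (auto simp: H_def indicator_def)
    also have "\<dots> = indicator G \<omega> * err k \<omega>"
      using fin \<omega> by (subst sum.delta') auto
    finally show ?thesis ..
  qed
  then have "(\<integral>\<omega>. indicator G \<omega> * err k \<omega> \<partial>M) =
      (\<integral>\<omega>. (\<Sum>v\<in>c k ` space M. indicator (H v) \<omega> * err k \<omega>) \<partial>M)"
    by (rule Bochner_Integration.integral_cong[OF refl])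
  also have "\<dots> = (\<Sum>v\<in>c k ` space M. \<integral>\<omega>. indicator (H v) \<omega> * err k \<omega> \<partial>M)"
    using integrable_mult_indicator[OF HM integrable_err[OF k]]
    by (intro Bochner_Integration.integral_sum) simp
  also have "\<dots> = 0"
    by (intro sum.neutral ballI integral_err_on_fibre[OF k H]) (simp add: H_def)
  finally show ?thesis .
qed

text \<open>
  The errors preceding step \<open>k\<close> generate a sigma-algebra coarser than \<open>past k\<close>, so it suffices that
  the error of step \<open>k\<close> integrates to zero over all events of \<open>past k\<close>. The family \<open>\<alpha>\<close> need agree
  with \<open>err\<close> only on the sample space and for the steps up to \<open>n\<close>.
\<close>

lemma mean_independent_err:
  assumes k: "k \<in> {1..n}"
    and \<alpha>: "\<And>j \<omega>. j \<in> {1..n} \<Longrightarrow> \<omega> \<in> space M \<Longrightarrow> \<alpha> j \<omega> = err j \<omega>"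
  shows "integrable M (\<alpha> k)" "integral\<^sup>L M (\<alpha> k) = 0"
    and "AE \<omega> in M. real_cond_exp M (gen_by M \<alpha> {1..<k}) (\<alpha> k) \<omega> = 0"
proof -
  have k': "k \<le> n + 1" using k by simp
  have sub: "sets (gen_by M \<alpha> {1..<k}) \<subseteq> sets (past k)"
  proof (rule sets_gen_by_subset)
    fix j assume "j \<in> {1..<k}"
    then have j: "j \<in> {1..n}" "j < k"
      using k by auto
    then have "err j \<in> borel_measurable (past k)"
      using k' by (rule measurable_err)
    with j(1)
    show "\<alpha> j \<in> borel_measurable (past k)"
      by (subst measurable_cong[where g = "err j"]) (simp_all add: \<alpha>)
  qed simp
  show int: "integrable M (\<alpha> k)"
    using integrable_err[OF k] \<alpha>[OF k] by (subst Bochner_Integration.integrable_cong[of M M _ "err k"]) auto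
  have zero: "(\<integral>\<omega>. indicator G \<omega> * \<alpha> k \<omega> \<partial>M) = 0" if "G \<in> sets (past k)" for G
  proof -
    have "(\<integral>\<omega>. indicator G \<omega> * \<alpha> k \<omega> \<partial>M) = (\<integral>\<omega>. indicator G \<omega> * err k \<omega> \<partial>M)"
      by (rule Bochner_Integration.integral_cong) (simp_all add: \<alpha>[OF k])
    then show ?thesis using integral_err_on_past_event[OF k that] by simp
  qed
  show "AE \<omega> in M. real_cond_exp M (gen_by M \<alpha> {1..<k}) (\<alpha> k) \<omega> = 0"
    using sub subalgebra_past[OF k'] zero
    by (intro real_cond_exp_eq_0 int) (auto simp: subalgebra_def)
  have "(\<integral>\<omega>. \<alpha> k \<omega> \<partial>M) = (\<integral>\<omega>. indicator (space (past k)) \<omega> * \<alpha> k \<omega> \<partial>M)"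
    by (rule Bochner_Integration.integral_cong) simp_all
  also have "\<dots> = 0" by (rule zero[OF sets.top])
  finally show "integral\<^sup>L M (\<alpha> k) = 0" .
qed

end

section \<open>Rounding errors of a sequence of operations\<close>

theorem lemma5:
  fixes M :: "'a measure" and p r n :: nat
    and ops :: "nat \<Rightarrow> elem_op" and x y :: "nat \<Rightarrow> real list \<Rightarrow> real"
    and c Z \<delta> \<beta> \<alpha> :: "nat \<Rightarrow> 'a \<Rightarrow> real" and B :: "nat \<Rightarrow> 'a \<Rightarrow> real"
  assumes "prob_space M"
    and "1 \<le> p" and "1 \<le> r" and "1 \<le> n"
    and "sr_sequence M p r n ops x y c Z"
    and "\<And>k \<omega>. k \<in> {1..n} \<Longrightarrow> \<omega> \<in> space M \<Longrightarrow>
           Z k \<omega> = c k \<omega> * (1 + \<delta> k \<omega>) \<and> (c k \<omega> = 0 \<longrightarrow> \<delta> k \<omega> = 0)"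
    and "\<And>k \<omega>. k \<in> {1..n} \<Longrightarrow> \<omega> \<in> space M \<Longrightarrow>
           fl_trunc (p + r) (c k \<omega>) = c k \<omega> * (1 + \<beta> k \<omega>) \<and> (c k \<omega> = 0 \<longrightarrow> \<beta> k \<omega> = 0)"
    and "\<And>k \<omega>. k \<in> {1..n} \<Longrightarrow> \<omega> \<in> space M \<Longrightarrow> \<alpha> k \<omega> = \<delta> k \<omega> - \<beta> k \<omega>"
    and "\<And>i \<omega>. B i \<omega> =
           (\<Sum>K | K \<subseteq> {i..n} \<and> K \<noteq> {i..n}.
              (\<Prod>l\<in>K. 1 + \<alpha> l \<omega>) * (\<Prod>j\<in>{i..n} - K. \<beta> j \<omega>))"
  shows "(\<forall>k\<in>{1..n}.
            integrable M (\<alpha> k) \<and>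
            (AE \<omega> in M. real_cond_exp M (gen_by M \<alpha> {1..<k}) (\<alpha> k) \<omega> = integral\<^sup>L M (\<alpha> k)) \<and>
            integral\<^sup>L M (\<alpha> k) = 0) \<and>
         (\<forall>i\<in>{1..n}. \<forall>\<omega>\<in>space M.
            (\<Prod>k\<in>{i..n}. 1 + \<delta> k \<omega>) = (\<Prod>k\<in>{i..n}. 1 + \<alpha> k \<omega>) + B i \<omega> \<and>
            \<bar>B i \<omega>\<bar> \<le> gam (n - i + 1) (u p + u (p + r)) - gam (n - i + 1) (u p))"
proof -
  interpret sr_process M p r n ops x y c Z
    using assms(1,2,5) by (simp add: sr_process_def sr_process_axioms_def)
  have \<alpha>: "\<alpha> k \<omega> = err k \<omega>" if "k \<in> {1..n}" "\<omega> \<in> space M" for k \<omega>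
  proof -
    have "Z k \<omega> - fl_trunc (p + r) (c k \<omega>) = c k \<omega> * (1 + \<delta> k \<omega>) - c k \<omega> * (1 + \<beta> k \<omega>)"
      using assms(6,7)[OF that] by simp
    also have "\<dots> = c k \<omega> * \<alpha> k \<omega>"
      by (simp add: assms(8)[OF that] algebra_simps)
    finally show ?thesis
      using assms(6-8)[OF that] by (cases "c k \<omega> = 0") (simp_all add: err_def)
  qed
  have \<beta>: "\<bar>\<beta> k \<omega>\<bar> \<le> u (p + r)" if "k \<in> {1..n}" "\<omega> \<in> space M" for k \<omega>
  proof (cases "c k \<omega> = 0")
    case True
    then show ?thesis using assms(7)[OF that] u_pos[of "p + r"] by simp
  next
    case False
    have "\<bar>c k \<omega>\<bar> * \<bar>\<beta> k \<omega>\<bar> = \<bar>fl_trunc (p + r) (c k \<omega>) - c k \<omega>\<bar>"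
      using assms(7)[OF that] by (simp add: algebra_simps flip: abs_mult)
    also have "\<dots> \<le> u (p + r) * \<bar>c k \<omega>\<bar>"
      using assms(2) False by (intro fl_trunc_error) auto
    finally show ?thesis using False by (simp add: mult.commute)
  qed
  show ?thesis
  proof (intro conjI ballI)
    fix k assume k: "k \<in> {1..n}"
    note mi = mean_independent_err[OF k, of \<alpha>, OF \<alpha>]
    show "integrable M (\<alpha> k)" "integral\<^sup>L M (\<alpha> k) = 0"
      "AE \<omega> in M. real_cond_exp M (gen_by M \<alpha> {1..<k}) (\<alpha> k) \<omega> = integral\<^sup>L M (\<alpha> k)"
      using mi by simp_all
  next
    fix i \<omega> assume i: "i \<in> {1..n}" and \<omega>: "\<omega> \<in> space M"
    have sub: "k \<in> {1..n}" if "k \<in> {i..n}" for k using that i by simp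
    have "(\<Prod>k\<in>{i..n}. 1 + \<delta> k \<omega>) = (\<Prod>k\<in>{i..n}. (1 + \<alpha> k \<omega>) + \<beta> k \<omega>)"
      using assms(8)[OF sub \<omega>] by (intro prod.cong) auto
    then show "(\<Prod>k\<in>{i..n}. 1 + \<delta> k \<omega>) = (\<Prod>k\<in>{i..n}. 1 + \<alpha> k \<omega>) + B i \<omega>"
      unfolding assms(9) by (simp only: prod_add_proper_subsets[OF finite_atLeastAtMost])
    have "\<bar>1 + \<alpha> k \<omega>\<bar> \<le> 1 + u p" if "k \<in> {i..n}" for k
      using err_bound[OF sub[OF that] \<omega>] \<alpha>[OF sub[OF that] \<omega>] by linarith
    then have "\<bar>B i \<omega>\<bar> \<le> (1 + u p + u (p + r)) ^ card {i..n} - (1 + u p) ^ card {i..n}"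
      unfolding assms(9) using \<beta>[OF sub \<omega>] by (intro proper_subset_sum_bound) auto
    moreover have "card {i..n} = n - i + 1" using i by (simp add: Suc_diff_le)
    ultimately show "\<bar>B i \<omega>\<bar> \<le> gam (n - i + 1) (u p + u (p + r)) - gam (n - i + 1) (u p)"
      by (simp only: gam_def add.assoc)
  qed
qed

end
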